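(* Let $K_1,K_2$ be two $\mathcal O$-operators on a Leibniz algebra $(\mathfrak g,[\ ,\ ])$ with respect to a representation $(V,\rho^L,\rho^R)$. If $K_1$ and $K_2$ are compatible and $K_1$ is invertible, then, with $S=K_1^{-1}K_2$ and $N=K_2K_1^{-1}$: (i) $(K_1,S,N)$ is a dual $\mathcal O$N-structure on $(\mathfrak g,[\ ,\ ])$ associated to $(V,\rho^L,\rho^R)$; (ii) $(K_2,S,N)$ is a dual $\mathcal O$N-structure on $(\mathfrak g,[\ ,\ ])$ associated to $(V,\rho^L,\rho^R)$.
   Context: $k$ is a field of characteristic $0$; all vector spaces are finite dimensional over $k$. A (left) Leibniz algebra $(\mathfrak g,[\ ,\ ])$ is a vector space with a bilinear bracket satisfying $[x,[y,z]]=[[x,y],z]+[y,[x,z]]$. A representation $(V,\rho^L,\rho^R)$ of it is a vector space $V$ with linear maps $\rho^L,\rho^R:\mathfrak g\to\mathfrak{gl}(V)$ such that for all $x,y\in\mathfrak g$: $\rho^L([x,y])=[\rho^L(x),\rho^L(y)]$, $\rho^R([x,y])=[\rho^L(x),\rho^R(y)]$ (commutators), and $\rho^R(y)\rho^L(x)=-\rho^R(y)\rho^R(x)$. An $\mathcal O$-operator on $\mathfrak g$ with respect to $(V,\rho^L,\rho^R)$ is a linear map $K:V\to\mathfrak g$ with $[K(u),K(v)]=K(\rho^L(K(u))v+\rho^R(K(v))u)$. Put $[u,v]^K=\rho^L(K(u))v+\rho^R(K(v))u$. Two $\mathcal O$-operators $K_1,K_2$ with respect to the same representation are compatible if $n_1K_1+n_2K_2$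 is an $\mathcal O$-operator for all $n_1,n_2\in k$. A Nijenhuis operator on $\mathfrak g$ is a linear endomorphism $N$ with $[N(x),N(y)]=N([N(x),y]+[x,N(y)]-N[x,y])$. A pair $(N,S)$, $N\in\mathfrak{gl}(\mathfrak g)$, $S\in\mathfrak{gl}(V)$, is a dual-Nijenhuis pair if $N$ is a Nijenhuis operator and for all $y\in\mathfrak g$, $w\in V$ and each $\rho\in\{\rho^L,\rho^R\}$: $\rho(N(y))S(w)=S(\rho(N(y))w)+\rho(y)S^2(w)-S(\rho(y)S(w))$. The triple $(K,S,N)$ is a dual $\mathcal O$N-structure if $K$ is an $\mathcal O$-operator, $(N,S)$ is a dual-Nijenhuis pair, $NK=KS$, and $[w,u]^{NK}=[w,u]_S^K$ for all $w,u\in V$, where $[w,u]^{NK}=\rho^L(NK(w))u+\rho^R(NK(u))w$ and $[w,u]_S^K=[S(w),u]^K+[w,S(u)]^K-S[w,u]^K$. *)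

theory Defs
  imports Complex_Main
begin

definition fin_dim_space ::
  "('k::field \<Rightarrow> 'v::ab_group_add \<Rightarrow> 'v) \<Rightarrow> bool"
  where "fin_dim_space s \<longleftrightarrow> (\<exists>B. finite_dimensional_vector_space s B)"

definition leibniz_algebra ::
  "('k::field_char_0 \<Rightarrow> 'g::ab_group_add \<Rightarrow> 'g) \<Rightarrow> ('g \<Rightarrow> 'g \<Rightarrow> 'g) \<Rightarrow> bool"
  where "leibniz_algebra sg br \<longleftrightarrow>
    fin_dim_space sg \<and>
    (\<forall>y. Vector_Spaces.linear sg sg (\<lambda>x. br x y)) \<and>
    (\<forall>x. Vector_Spaces.linear sg sg (br x)) \<and>
    (\<forall>x y z. br x (br y z) = br (br x y) z + br y (br x z))"

definition commutator ::
  "('v::ab_group_add \<Rightarrow> 'v) \<Rightarrow> ('v \<Rightarrow> 'v) \<Rightarrow> 'v \<Rightarrow> 'v"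
  where "commutator f h = (\<lambda>v. f (h v) - h (f v))"

text \<open>Linearity of a map from the algebra to the endomorphisms of \<open>V\<close>, spelled out
  pointwise since the function space carries no vector space structure here.\<close>

definition linear_action ::
  "('k::field_char_0 \<Rightarrow> 'g::ab_group_add \<Rightarrow> 'g) \<Rightarrow> ('k \<Rightarrow> 'v::ab_group_add \<Rightarrow> 'v) \<Rightarrow>
   ('g \<Rightarrow> 'v \<Rightarrow> 'v) \<Rightarrow> bool"
  where "linear_action sg sv \<rho> \<longleftrightarrow>
    (\<forall>x. Vector_Spaces.linear sv sv (\<rho> x)) \<and>
    (\<forall>v. Vector_Spaces.linear sg sv (\<lambda>x. \<rho> x v))"

definition leibniz_representation ::
  "('k::field_char_0 \<Rightarrow> 'g::ab_group_add \<Rightarrow> 'g) \<Rightarrow> ('g \<Rightarrow> 'g \<Rightarrow> 'g) \<Rightarrow>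
   ('k \<Rightarrow> 'v::ab_group_add \<Rightarrow> 'v) \<Rightarrow> ('g \<Rightarrow> 'v \<Rightarrow> 'v) \<Rightarrow> ('g \<Rightarrow> 'v \<Rightarrow> 'v) \<Rightarrow> bool"
  where "leibniz_representation sg br sv \<rho>L \<rho>R \<longleftrightarrow>
    fin_dim_space sv \<and> linear_action sg sv \<rho>L \<and> linear_action sg sv \<rho>R \<and>
    (\<forall>x y. \<rho>L (br x y) = commutator (\<rho>L x) (\<rho>L y)) \<and>
    (\<forall>x y. \<rho>R (br x y) = commutator (\<rho>L x) (\<rho>R y)) \<and>
    (\<forall>x y v. \<rho>R y (\<rho>L x v) = - \<rho>R y (\<rho>R x v))"

definition op_bracket ::
  "('g \<Rightarrow> 'v::ab_group_add \<Rightarrow> 'v) \<Rightarrow> ('g \<Rightarrow> 'v \<Rightarrow> 'v) \<Rightarrow> ('v \<Rightarrow> 'g) \<Rightarrow> 'v \<Rightarrow> 'v \<Rightarrow> 'v"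
  where "op_bracket \<rho>L \<rho>R K u v = \<rho>L (K u) v + \<rho>R (K v) u"

definition O_operator ::
  "('k::field_char_0 \<Rightarrow> 'g::ab_group_add \<Rightarrow> 'g) \<Rightarrow> ('g \<Rightarrow> 'g \<Rightarrow> 'g) \<Rightarrow>
   ('k \<Rightarrow> 'v::ab_group_add \<Rightarrow> 'v) \<Rightarrow> ('g \<Rightarrow> 'v \<Rightarrow> 'v) \<Rightarrow> ('g \<Rightarrow> 'v \<Rightarrow> 'v) \<Rightarrow>
   ('v \<Rightarrow> 'g) \<Rightarrow> bool"
  where "O_operator sg br sv \<rho>L \<rho>R K \<longleftrightarrow>
    Vector_Spaces.linear sv sg K \<and>
    (\<forall>u v. br (K u) (K v) = K (op_bracket \<rho>L \<rho>R K u v))"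

definition compatible_O_operators ::
  "('k::field_char_0 \<Rightarrow> 'g::ab_group_add \<Rightarrow> 'g) \<Rightarrow> ('g \<Rightarrow> 'g \<Rightarrow> 'g) \<Rightarrow>
   ('k \<Rightarrow> 'v::ab_group_add \<Rightarrow> 'v) \<Rightarrow> ('g \<Rightarrow> 'v \<Rightarrow> 'v) \<Rightarrow> ('g \<Rightarrow> 'v \<Rightarrow> 'v) \<Rightarrow>
   ('v \<Rightarrow> 'g) \<Rightarrow> ('v \<Rightarrow> 'g) \<Rightarrow> bool"
  where "compatible_O_operators sg br sv \<rho>L \<rho>R K\<^sub>1 K\<^sub>2 \<longleftrightarrow>
    (\<forall>n\<^sub>1 n\<^sub>2. O_operator sg br sv \<rho>L \<rho>R (\<lambda>v. sg n\<^sub>1 (K\<^sub>1 v) + sg n\<^sub>2 (K\<^sub>2 v)))"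

definition nijenhuis_operator ::
  "('k::field_char_0 \<Rightarrow> 'g::ab_group_add \<Rightarrow> 'g) \<Rightarrow> ('g \<Rightarrow> 'g \<Rightarrow> 'g) \<Rightarrow> ('g \<Rightarrow> 'g) \<Rightarrow> bool"
  where "nijenhuis_operator sg br N \<longleftrightarrow>
    Vector_Spaces.linear sg sg N \<and>
    (\<forall>x y. br (N x) (N y) = N (br (N x) y + br x (N y) - N (br x y)))"

definition dual_nijenhuis_pair ::
  "('k::field_char_0 \<Rightarrow> 'g::ab_group_add \<Rightarrow> 'g) \<Rightarrow> ('g \<Rightarrow> 'g \<Rightarrow> 'g) \<Rightarrow>
   ('k \<Rightarrow> 'v::ab_group_add \<Rightarrow> 'v) \<Rightarrow> ('g \<Rightarrow> 'v \<Rightarrow> 'v) \<Rightarrow> ('g \<Rightarrow> 'v \<Rightarrow> 'v) \<Rightarrow>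
   ('g \<Rightarrow> 'g) \<Rightarrow> ('v \<Rightarrow> 'v) \<Rightarrow> bool"
  where "dual_nijenhuis_pair sg br sv \<rho>L \<rho>R N S \<longleftrightarrow>
    nijenhuis_operator sg br N \<and> Vector_Spaces.linear sv sv S \<and>
    (\<forall>\<rho>\<in>{\<rho>L, \<rho>R}. \<forall>y w.
      \<rho> (N y) (S w) = S (\<rho> (N y) w) + \<rho> y (S (S w)) - S (\<rho> y (S w)))"

definition deformed_op_bracket ::
  "('g \<Rightarrow> 'v::ab_group_add \<Rightarrow> 'v) \<Rightarrow> ('g \<Rightarrow> 'v \<Rightarrow> 'v) \<Rightarrow> ('v \<Rightarrow> 'g) \<Rightarrow> ('v \<Rightarrow> 'v) \<Rightarrow>
   'v \<Rightarrow> 'v \<Rightarrow> 'v"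
  where "deformed_op_bracket \<rho>L \<rho>R K S w u =
    op_bracket \<rho>L \<rho>R K (S w) u + op_bracket \<rho>L \<rho>R K w (S u) - S (op_bracket \<rho>L \<rho>R K w u)"

definition dual_ON_structure ::
  "('k::field_char_0 \<Rightarrow> 'g::ab_group_add \<Rightarrow> 'g) \<Rightarrow> ('g \<Rightarrow> 'g \<Rightarrow> 'g) \<Rightarrow>
   ('k \<Rightarrow> 'v::ab_group_add \<Rightarrow> 'v) \<Rightarrow> ('g \<Rightarrow> 'v \<Rightarrow> 'v) \<Rightarrow> ('g \<Rightarrow> 'v \<Rightarrow> 'v) \<Rightarrow>
   ('v \<Rightarrow> 'g) \<Rightarrow> ('v \<Rightarrow> 'v) \<Rightarrow> ('g \<Rightarrow> 'g) \<Rightarrow> bool"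
  where "dual_ON_structure sg br sv \<rho>L \<rho>R K S N \<longleftrightarrow>
    O_operator sg br sv \<rho>L \<rho>R K \<and>
    dual_nijenhuis_pair sg br sv \<rho>L \<rho>R N S \<and>
    N \<circ> K = K \<circ> S \<and>
    (\<forall>w u. op_bracket \<rho>L \<rho>R (N \<circ> K) w u = deformed_op_bracket \<rho>L \<rho>R K S w u)"

end

theory Submission
  imports Defs
begin

text \<open>Write \<open>[u,v]\<^sup>K\<close> for \<open>op_bracket \<rho>L \<rho>R K u v\<close>. The whole statement is governed by one
  identity, required of a map \<open>K : V \<rightarrow> \<gg>\<close> and an endomorphism \<open>S\<close> of \<open>V\<close>:
  \[ \rho^L(K u)\,S v + \rho^R(K v)\,S u = S\,[u,v]^K. \]
  It holds for \<open>K\<^sub>1\<close> and for \<open>K\<^sub>2 = K\<^sub>1 S\<close>, and in both cases the proof is to write all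
  brackets as values of \<open>K\<^sub>1\<close>, which is injective, and cancel it:
  for \<open>K\<^sub>1\<close> it is what remains of the polarised compatibility condition
  (\<open>compatible_mixed_bracket\<close>), and for \<open>K\<^sub>2\<close> it is the \<open>\<O>\<close>-operator equation of \<open>K\<^sub>2\<close> itself.

  Everything else follows formally. For a fixed \<open>K\<close> the identity says precisely that the bracket
  of \<open>K S\<close> is the bracket of \<open>K\<close> deformed by \<open>S\<close> (\<open>deformed_op_bracket_iff\<close>), which is the last
  condition in a dual \<open>\<O>N\<close>-structure, for \<open>K\<^sub>1\<close> and for \<open>K\<^sub>2\<close>. The two identities
  together give the conditions on \<open>\<rho>\<^sup>L\<close> and \<open>\<rho>\<^sup>R\<close> in a dual-Nijenhuis pair
  (\<open>twisted_action_transfer\<close>). Finally, the Nijenhuis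
  condition on \<open>N\<close>, tested on the values of \<open>K\<^sub>1\<close>, is again the polarised compatibility condition
  combined with the \<open>\<O>\<close>-operator equation of \<open>K\<^sub>2\<close>.\<close>

lemma linear_inv_of_bij:
  assumes "Vector_Spaces.linear s1 s2 f" and "bij f"
  shows "Vector_Spaces.linear s2 s1 (inv f)"
proof -
  interpret Vector_Spaces.linear s1 s2 f by fact
  have f_inv: "f (inv f x) = x" and inv_f: "inv f (f v) = v" for x v
    using assms(2) by (simp_all add: bij_is_surj surj_f_inv_f bij_is_inj)
  show ?thesis
  proof (unfold_locales)
    show "inv f (x + y) = inv f x + inv f y" for x y
      by (metis add f_inv inv_f)
    show "inv f (s2 c x) = s1 c (inv f x)" for c x
      by (metis scale f_inv inv_f)
  qed
qed

text \<open>Subtracting from the \<open>\<O>\<close>-operator equation of \<open>K\<^sub>1 + K\<^sub>2\<close> the equations of \<open>K\<^sub>1\<close> and of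
  \<open>K\<^sub>2\<close> leaves the terms in which both maps occur.\<close>

lemma compatible_mixed_bracket:
  assumes alg: "leibniz_algebra sg br"
    and rep: "leibniz_representation sg br sv \<rho>L \<rho>R"
    and K1: "O_operator sg br sv \<rho>L \<rho>R K\<^sub>1"
    and K2: "O_operator sg br sv \<rho>L \<rho>R K\<^sub>2"
    and comp: "compatible_O_operators sg br sv \<rho>L \<rho>R K\<^sub>1 K\<^sub>2"
  shows "br (K\<^sub>1 u) (K\<^sub>2 v) + br (K\<^sub>2 u) (K\<^sub>1 v) =
    K\<^sub>1 (op_bracket \<rho>L \<rho>R K\<^sub>2 u v) + K\<^sub>2 (op_bracket \<rho>L \<rho>R K\<^sub>1 u v)"
proof -
  have linK1: "Vector_Spaces.linear sv sg K\<^sub>1" and linK2: "Vector_Spaces.linear sv sg K\<^sub>2"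
    using K1 K2 by (simp_all add: O_operator_def)
  interpret K1: Vector_Spaces.linear sv sg K\<^sub>1 by fact
  interpret K2: Vector_Spaces.linear sv sg K\<^sub>2 by fact
  have br_add: "br (x + x') y = br x y + br x' y" "br x (y + y') = br x y + br x y'" for x x' y y'
    using alg unfolding leibniz_algebra_def Vector_Spaces.linear_iff by blast+
  have act_add: "\<rho>L (x + x') w = \<rho>L x w + \<rho>L x' w" "\<rho>R (x + x') w = \<rho>R x w + \<rho>R x' w" for x x' w
    using rep
    by (simp_all add: leibniz_representation_def linear_action_def Vector_Spaces.linear_iff)
  let ?K = "\<lambda>v. K\<^sub>1 v + K\<^sub>2 v"
  have "O_operator sg br sv \<rho>L \<rho>R (\<lambda>v. sg 1 (K\<^sub>1 v) + sg 1 (K\<^sub>2 v))"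
    using comp unfolding compatible_O_operators_def by blast
  then have "br (?K u) (?K v) = ?K (op_bracket \<rho>L \<rho>R ?K u v)"
    by (simp add: O_operator_def)
  moreover have "op_bracket \<rho>L \<rho>R ?K u v = op_bracket \<rho>L \<rho>R K\<^sub>1 u v + op_bracket \<rho>L \<rho>R K\<^sub>2 u v"
    by (simp add: op_bracket_def act_add)
  moreover have "br (K\<^sub>1 u) (K\<^sub>1 v) = K\<^sub>1 (op_bracket \<rho>L \<rho>R K\<^sub>1 u v)"
      "br (K\<^sub>2 u) (K\<^sub>2 v) = K\<^sub>2 (op_bracket \<rho>L \<rho>R K\<^sub>2 u v)"
    using K1 K2 by (simp_all add: O_operator_def)
  ultimately show ?thesis
    by (simp add: br_add K1.add K2.add algebra_simps)
qed

text \<open>In the deformed bracket, \<open>\<rho>L (K (S u)) v\<close> and \<open>\<rho>R (K (S v)) u\<close> already make up the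
  bracket of \<open>K \<circ> S\<close>; equality means that the remaining terms cancel.\<close>

lemma deformed_op_bracket_iff:
  "op_bracket \<rho>L \<rho>R (K \<circ> S) u v = deformed_op_bracket \<rho>L \<rho>R K S u v \<longleftrightarrow>
    \<rho>L (K u) (S v) + \<rho>R (K v) (S u) = S (op_bracket \<rho>L \<rho>R K u v)"
  by (auto simp: op_bracket_def deformed_op_bracket_def algebra_simps)

text \<open>With \<open>D\<^sup>L\<^sub>K(u,v) = \<rho>L (K u) (S v) - S (\<rho>L (K u) v)\<close> and
  \<open>D\<^sup>R\<^sub>K(u,v) = \<rho>R (K v) (S u) - S (\<rho>R (K v) u)\<close>, the hypotheses say that
  \<open>D\<^sup>L + D\<^sup>R = 0\<close> for \<open>K\<close> and for \<open>K \<circ> S\<close>. Since \<open>D\<^sup>R\<^sub>K(u, S v) = D\<^sup>R\<^sub>K\<^sub>S(u, v)\<close>, each left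
  defect can be exchanged for a right one and back, whence \<open>D\<^sup>L\<^sub>K(u, S v) = D\<^sup>L\<^sub>K\<^sub>S(u, v)\<close>; this is the
  first conclusion, and the second arises with the two sides interchanged.\<close>

lemma twisted_action_transfer:
  assumes addS: "\<And>a b. S (a + b) = S a + S b"
    and K: "\<And>u v. \<rho>L (K u) (S v) + \<rho>R (K v) (S u) = S (op_bracket \<rho>L \<rho>R K u v)"
    and KS: "\<And>u v. \<rho>L (K (S u)) (S v) + \<rho>R (K (S v)) (S u) = S (op_bracket \<rho>L \<rho>R (K \<circ> S) u v)"
  shows "\<rho>L (K (S u)) (S w) = S (\<rho>L (K (S u)) w) + \<rho>L (K u) (S (S w)) - S (\<rho>L (K u) (S w))"
    and "\<rho>R (K (S u)) (S w) = S (\<rho>R (K (S u)) w) + \<rho>R (K u) (S (S w)) - S (\<rho>R (K u) (S w))"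
proof -
  have K': "\<rho>L (K a) (S b) = S (\<rho>L (K a) b) + S (\<rho>R (K b) a) - \<rho>R (K b) (S a)" for a b
    using K[of a b] by (simp add: op_bracket_def addS eq_diff_eq)
  have KS': "\<rho>L (K (S a)) (S b) =
      S (\<rho>L (K (S a)) b) + S (\<rho>R (K (S b)) a) - \<rho>R (K (S b)) (S a)" for a b
    using KS[of a b] by (simp add: op_bracket_def addS eq_diff_eq)
  show "\<rho>L (K (S u)) (S w) = S (\<rho>L (K (S u)) w) + \<rho>L (K u) (S (S w)) - S (\<rho>L (K u) (S w))"
    unfolding KS'[of u w] K'[of u "S w"] by simp
  show "\<rho>R (K (S u)) (S w) = S (\<rho>R (K (S u)) w) + \<rho>R (K u) (S (S w)) - S (\<rho>R (K u) (S w))"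
    using KS'[of w u] K'[of "S w" u] by (simp add: algebra_simps)
qed

theorem proposition4p8:
  fixes sg :: "'k::field_char_0 \<Rightarrow> 'g::ab_group_add \<Rightarrow> 'g"
    and br :: "'g \<Rightarrow> 'g \<Rightarrow> 'g"
    and sv :: "'k \<Rightarrow> 'v::ab_group_add \<Rightarrow> 'v"
    and \<rho>L \<rho>R :: "'g \<Rightarrow> 'v \<Rightarrow> 'v"
    and K\<^sub>1 K\<^sub>2 :: "'v \<Rightarrow> 'g"
    and S :: "'v \<Rightarrow> 'v" and N :: "'g \<Rightarrow> 'g"
  assumes "leibniz_algebra sg br"
    and "leibniz_representation sg br sv \<rho>L \<rho>R"
    and "O_operator sg br sv \<rho>L \<rho>R K\<^sub>1"
    and "O_operator sg br sv \<rho>L \<rho>R K\<^sub>2"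
    and "compatible_O_operators sg br sv \<rho>L \<rho>R K\<^sub>1 K\<^sub>2"
    and "bij K\<^sub>1"
    and "S = inv K\<^sub>1 \<circ> K\<^sub>2"
    and "N = K\<^sub>2 \<circ> inv K\<^sub>1"
  shows "dual_ON_structure sg br sv \<rho>L \<rho>R K\<^sub>1 S N \<and>
         dual_ON_structure sg br sv \<rho>L \<rho>R K\<^sub>2 S N"
proof -
  note alg = assms(1) and rep = assms(2) and O1 = assms(3) and O2 = assms(4)
  have lin1: "Vector_Spaces.linear sv sg K\<^sub>1" and lin2: "Vector_Spaces.linear sv sg K\<^sub>2"
    and br1: "\<And>u v. br (K\<^sub>1 u) (K\<^sub>1 v) = K\<^sub>1 (op_bracket \<rho>L \<rho>R K\<^sub>1 u v)"
    and br2: "\<And>u v. br (K\<^sub>2 u) (K\<^sub>2 v) = K\<^sub>2 (op_bracket \<rho>L \<rho>R K\<^sub>2 u v)"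
    using O1 O2 by (simp_all add: O_operator_def)
  interpret K1: Vector_Spaces.linear sv sg K\<^sub>1 by fact
  have lin_inv: "Vector_Spaces.linear sg sv (inv K\<^sub>1)"
    using lin1 assms(6) by (rule linear_inv_of_bij)
  have linS: "Vector_Spaces.linear sv sv S" and linN: "Vector_Spaces.linear sg sg N"
    unfolding assms(7,8) using lin_inv lin2 by (blast intro: Vector_Spaces.linear_compose)+
  have inj1: "K\<^sub>1 a = K\<^sub>1 b \<longleftrightarrow> a = b" for a b
    using assms(6) by (simp add: bij_is_inj inj_eq)
  have surj1: "\<exists>u. y = K\<^sub>1 u" for y
    using assms(6) by (meson bij_pointE)
  have K1S: "K\<^sub>1 (S v) = K\<^sub>2 v" and NK1: "N (K\<^sub>1 v) = K\<^sub>2 v" for v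
    using assms(6) by (simp_all add: assms(7,8) bij_is_surj surj_f_inv_f bij_is_inj)
  have K1S_comp: "K\<^sub>1 \<circ> S = K\<^sub>2"
    by (simp add: fun_eq_iff K1S)
  have NK1_comp: "N \<circ> K\<^sub>1 = K\<^sub>1 \<circ> S" and NK2_comp: "N \<circ> K\<^sub>2 = K\<^sub>2 \<circ> S"
    by (metis comp_apply ext K1S NK1)+
  have mixed: "br (K\<^sub>1 u) (K\<^sub>2 v) + br (K\<^sub>2 u) (K\<^sub>1 v) =
      K\<^sub>1 (op_bracket \<rho>L \<rho>R K\<^sub>2 u v) + K\<^sub>2 (op_bracket \<rho>L \<rho>R K\<^sub>1 u v)" for u v
    using compatible_mixed_bracket[OF alg rep O1 O2 assms(5)] .

  have twist1: "\<rho>L (K\<^sub>1 u) (S v) + \<rho>R (K\<^sub>1 v) (S u) = S (op_bracket \<rho>L \<rho>R K\<^sub>1 u v)" for u v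
  proof -
    have "K\<^sub>1 (op_bracket \<rho>L \<rho>R K\<^sub>1 u (S v) + op_bracket \<rho>L \<rho>R K\<^sub>1 (S u) v) =
        K\<^sub>1 (op_bracket \<rho>L \<rho>R K\<^sub>2 u v + S (op_bracket \<rho>L \<rho>R K\<^sub>1 u v))"
      using mixed[of u v] by (simp add: K1.add K1S flip: br1)
    then show ?thesis
      unfolding inj1 by (simp add: op_bracket_def K1S algebra_simps)
  qed
  have twist2: "\<rho>L (K\<^sub>2 u) (S v) + \<rho>R (K\<^sub>2 v) (S u) = S (op_bracket \<rho>L \<rho>R K\<^sub>2 u v)" for u v
  proof -
    have "K\<^sub>1 (op_bracket \<rho>L \<rho>R K\<^sub>1 (S u) (S v)) = K\<^sub>1 (S (op_bracket \<rho>L \<rho>R K\<^sub>2 u v))"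
      by (simp add: K1S br2 flip: br1)
    then show ?thesis
      unfolding inj1 by (simp add: op_bracket_def K1S)
  qed

  have "br (N x) (N y) = N (br (N x) y + br x (N y) - N (br x y))" for x y
  proof -
    obtain u v where "x = K\<^sub>1 u" "y = K\<^sub>1 v"
      using surj1 by metis
    moreover have "br (K\<^sub>2 u) (K\<^sub>1 v) + br (K\<^sub>1 u) (K\<^sub>2 v) - K\<^sub>2 (op_bracket \<rho>L \<rho>R K\<^sub>1 u v) =
        K\<^sub>1 (op_bracket \<rho>L \<rho>R K\<^sub>2 u v)"
      using mixed[of u v] by (simp add: algebra_simps)
    ultimately show ?thesis
      by (simp add: NK1 br1 br2)
  qed
  then have nijenhuis: "nijenhuis_operator sg br N"
    using linN by (simp add: nijenhuis_operator_def)

  have addS: "S (a + b) = S a + S b" for a b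
    using linS by (simp add: Vector_Spaces.linear_iff)
  have twist2': "\<rho>L (K\<^sub>1 (S u)) (S v) + \<rho>R (K\<^sub>1 (S v)) (S u) =
      S (op_bracket \<rho>L \<rho>R (K\<^sub>1 \<circ> S) u v)" for u v
    unfolding K1S K1S_comp by (rule twist2)
  have "\<rho>L (N y) (S w) = S (\<rho>L (N y) w) + \<rho>L y (S (S w)) - S (\<rho>L y (S w)) \<and>
      \<rho>R (N y) (S w) = S (\<rho>R (N y) w) + \<rho>R y (S (S w)) - S (\<rho>R y (S w))" for y w
  proof -
    obtain u where y: "y = K\<^sub>1 u"
      using surj1 by blast
    show ?thesis
      using twisted_action_transfer[where K = K\<^sub>1, OF addS twist1 twist2', of u w]
      unfolding y NK1 K1S by blast
  qed
  then have pair: "dual_nijenhuis_pair sg br sv \<rho>L \<rho>R N S"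
    using nijenhuis linS by (simp add: dual_nijenhuis_pair_def)

  show ?thesis
    unfolding dual_ON_structure_def NK1_comp NK2_comp deformed_op_bracket_iff
    using O1 O2 pair twist1 twist2 by blast
qed

end
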